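(* Let $N\ge 5$ be an odd integer. Then \[ \mathrm{Kf}(G_N^{(1)})=\frac{N^2(1-\beta^N)}{\sqrt{\Delta}\,(1+\beta^N)}-1, \] where $\Delta=N(N-4)$ and $\beta=\frac{N-2-\sqrt{\Delta}}{2}$.
   Context: $G_N^{(1)}=K_N\setminus C_N$ is the graph on $\mathbb Z/N\mathbb Z$ in which distinct $x,y$ are adjacent iff $x-y\not\equiv\pm1\pmod N$. For a connected graph with Laplacian matrix $L$ (degree matrix minus adjacency matrix) and Moore--Penrose pseudoinverse $L^+$, the effective resistance is $R(x,y)=(e_x-e_y)^*L^+(e_x-e_y)$. The Kirchhoff index of a graph $G=(V,E)$ is $\mathrm{Kf}(G)=\frac12\sum_{x,y\in V}R(x,y)$, the sum being over ordered pairs. *)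

theory Defs
  imports
    "HOL-Number_Theory.Cong"
    "Graph_Theory.Graph_Theory"
    "Jordan_Normal_Form.Schur_Decomposition"
begin

text \<open>
  Finite simple graphs are rendered, as usual in \<^theory>\<open>Graph_Theory.Graph_Theory\<close>, by finite
  loop-free symmetric digraphs (locale \<^locale>\<open>pair_graph\<close>). In order to index matrices by
  vertices, the definitions below are meant for graphs with vertex set \<open>{0..<n}\<close>.
\<close>

definition adjacency_matrix :: "nat pair_pre_digraph \<Rightarrow> real mat" where
  "adjacency_matrix G = mat (card (pverts G)) (card (pverts G))
     (\<lambda>(i, j). if i \<rightarrow>\<^bsub>G\<^esub> j then 1 else 0)"

definition degree_matrix :: "nat pair_pre_digraph \<Rightarrow> real mat" where
  "degree_matrix G = mat (card (pverts G)) (card (pverts G))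
     (\<lambda>(i, j). if i = j then real (out_degree G i) else 0)"

definition laplacian :: "nat pair_pre_digraph \<Rightarrow> real mat" where
  "laplacian G = degree_matrix G - adjacency_matrix G"

text \<open>The four Penrose conditions; over the reals and complex numbers such an \<open>X\<close> always exists.\<close>
definition is_pseudoinverse :: "'a::conjugatable_field mat \<Rightarrow> 'a mat \<Rightarrow> bool" where
  "is_pseudoinverse A X \<longleftrightarrow>
     X \<in> carrier_mat (dim_col A) (dim_row A) \<and>
     A * X * A = A \<and> X * A * X = X \<and>
     mat_adjoint (A * X) = A * X \<and> mat_adjoint (X * A) = X * A"

definition pseudoinverse :: "'a::conjugatable_field mat \<Rightarrow> 'a mat" where
  "pseudoinverse A = (THE X. is_pseudoinverse A X)"

text \<open>
  The scalar product \<open>\<bullet>c\<close> conjugates its right argument, so \<open>(M *\<^sub>v d) \<bullet>c d\<close> is \<open>d\<^sup>* M d\<close>.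
  The notion is intended for connected \<open>G\<close> only.
\<close>
definition effective_resistance :: "nat pair_pre_digraph \<Rightarrow> nat \<Rightarrow> nat \<Rightarrow> real" where
  "effective_resistance G x y =
     (let n = card (pverts G); d = unit_vec n x - unit_vec n y
      in (pseudoinverse (laplacian G) *\<^sub>v d) \<bullet>c d)"

definition kirchhoff_index :: "nat pair_pre_digraph \<Rightarrow> real" where
  "kirchhoff_index G =
     (1 / 2) * (\<Sum>x\<in>pverts G. \<Sum>y\<in>pverts G. effective_resistance G x y)"

text \<open>The complement of the cycle; the residue classes modulo \<open>N\<close> are represented by \<open>{0..<N}\<close>.\<close>
definition G1 :: "nat \<Rightarrow> nat pair_pre_digraph" where
  "G1 N = \<lparr> pverts = {0..<N},
            parcs = {(x, y). x \<in> {0..<N} \<and> y \<in> {0..<N} \<and> x \<noteq> y \<and>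
                       \<not> [int x - int y = 1] (mod int N) \<and>
                       \<not> [int x - int y = -1] (mod int N)} \<rparr>"

lemma mat_adjoint_carrier:
  "A \<in> carrier_mat n m \<Longrightarrow> mat_adjoint A \<in> carrier_mat m n"
  by (auto simp: mat_adjoint_def)

lemma mat_adjoint_index:
  "i < dim_col A \<Longrightarrow> j < dim_row A \<Longrightarrow> mat_adjoint A $$ (i, j) = conjugate (A $$ (j, i))"
  by (simp add: mat_adjoint_def mat_of_rows_index)

lemma mat_adjoint_mult:
  fixes A B :: "'a::conjugatable_field mat"
  assumes A: "A \<in> carrier_mat n m" and B: "B \<in> carrier_mat m k"
  shows "mat_adjoint (A * B) = mat_adjoint B * mat_adjoint A"
proof (rule eq_matI)
  note c = A B mat_adjoint_carrier[OF A] mat_adjoint_carrier[OF B]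
  fix i j assume "i < dim_row (mat_adjoint B * mat_adjoint A)"
    and "j < dim_col (mat_adjoint B * mat_adjoint A)"
  then have i: "i < k" and j: "j < n" using c by auto
  have s: "conjugate (sum f S) = (\<Sum>x\<in>S. conjugate (f x))" if "finite S"
    for f :: "nat \<Rightarrow> 'a" and S
    using that by (induction S) (auto simp: conjugate_dist_add)
  show "mat_adjoint (A * B) $$ (i, j) = (mat_adjoint B * mat_adjoint A) $$ (i, j)"
    using c i j
    by (simp add: mat_adjoint_index scalar_prod_def s conjugate_dist_mul)
      (rule sum.cong, auto simp: mat_adjoint_index mult.commute)
qed (use A B in \<open>auto simp: mat_adjoint_def\<close>)

text \<open>Uniqueness for the definite description in \<^const>\<open>pseudoinverse\<close>.\<close>
lemma is_pseudoinverse_unique: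
  fixes A :: "'a::conjugatable_field mat"
  assumes X: "is_pseudoinverse A X" and Y: "is_pseudoinverse A Y"
  shows "X = Y"
proof -
  define n m where "n = dim_row A" and "m = dim_col A"
  have A: "A \<in> carrier_mat n m" by (simp add: n_def m_def)
  have cX: "X \<in> carrier_mat m n" and cY: "Y \<in> carrier_mat m n"
    using X Y by (auto simp: is_pseudoinverse_def n_def m_def)
  note x = X[unfolded is_pseudoinverse_def] and y = Y[unfolded is_pseudoinverse_def]
  have cAX: "A * X \<in> carrier_mat n n" and cAY: "A * Y \<in> carrier_mat n n"
    and cXA: "X * A \<in> carrier_mat m m" and cYA: "Y * A \<in> carrier_mat m m"
    using A cX cY by auto
  have "A * X = (A * Y * A) * X" using y by simp
  also have "\<dots> = (A * Y) * (A * X)" using A cX cAY by simp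
  also have "\<dots> = mat_adjoint (A * Y) * mat_adjoint (A * X)" using x y by simp
  also have "\<dots> = mat_adjoint ((A * X) * (A * Y))" using mat_adjoint_mult[OF cAX cAY] by simp
  also have "(A * X) * (A * Y) = (A * X * A) * Y"
    using A cY cAX by simp
  also have "mat_adjoint \<dots> = A * Y" using x y by simp
  finally have 1: "A * X = A * Y" .
  have "X * A = X * (A * Y * A)" using y by simp
  also have "\<dots> = (X * A) * (Y * A)"
    using assoc_mult_mat[OF cX A cYA] A cY by simp
  also have "\<dots> = mat_adjoint (X * A) * mat_adjoint (Y * A)" using x y by simp
  also have "\<dots> = mat_adjoint ((Y * A) * (X * A))" using mat_adjoint_mult[OF cYA cXA] by simp
  also have "(Y * A) * (X * A) = Y * (A * X * A)"
    using assoc_mult_mat[OF cY A cXA] A cX by simp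
  also have "mat_adjoint \<dots> = Y * A" using x y by simp
  finally have 2: "X * A = Y * A" .
  have "X = (X * A) * X" using x by simp
  also have "\<dots> = Y * (A * X)" using 2 A cX cY by simp
  also have "\<dots> = Y * A * Y" using 1 A cY by simp
  also have "\<dots> = Y" using y by simp
  finally show ?thesis .
qed

corollary pseudoinverse_eqI: "is_pseudoinverse A X \<Longrightarrow> pseudoinverse A = X"
  unfolding pseudoinverse_def by (blast intro: is_pseudoinverse_unique)

lemma pair_graph_G1: "pair_graph (G1 N)"
proof -
  have s: "[int y - int x = 1] (mod int N) \<longleftrightarrow> [int x - int y = -1] (mod int N)" for x y
    using cong_minus_minus_iff[of "int y - int x" 1 "int N"] by simp
  have "finite (parcs (G1 N))"
    by (rule finite_subset[of _ "{0..<N} \<times> {0..<N}"]) (auto simp: G1_def)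
  then show ?thesis
    by unfold_locales (auto simp: G1_def symmetric_def sym_def s)
qed

lemma connected_G1:
  assumes N: "N \<ge> 5"
  shows "Digraph_Component.connected (G1 N)"
proof -
  interpret pair_graph "G1 N" by (rule pair_graph_G1)
  have arc: "(x, y) \<in> parcs (G1 N)"
    if "x < N" "y < N" "(int x - int y) mod int N \<notin> {0, 1, int N - 1}" for x y
    using that N zmod_minus1[of "int N"] by (auto simp: G1_def cong_def)
  have r: "x \<rightarrow>\<^sup>*\<^bsub>G1 N\<^esub> y" if xy: "x < N" "y < N" for x y
  proof (cases "x = y \<or> (x, y) \<in> parcs (G1 N)")
    case True
    moreover have "pverts (G1 N) = {0..<N}" by (simp add: G1_def)
    ultimately show ?thesis using xy reachable_refl[of x] reachable_adjI[of x y] by (metis atLeast0LessThan lessThan_iff)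
  next
    case False
    have step: "u \<rightarrow>\<^sup>*\<^bsub>G1 N\<^esub> v"
      if uv: "u < N" "v < N" "[int u - int v = 1] (mod int N)" for u v
    proof -
      define w where "w = nat ((int v + 3) mod int N)"
      have w: "w < N" "int w = (int v + 3) mod int N"
        using N by (auto simp: w_def nat_less_iff)
      have "(int w - int v) mod int N = 3 mod int N"
        unfolding w by (simp add: mod_simps)
      then have wv: "(w, v) \<in> parcs (G1 N)" using arc[of w v] w uv N by simp
      have "(int u - int w) mod int N = (int u - int v - 3) mod int N"
        unfolding w by (simp add: mod_simps algebra_simps)
      also have "\<dots> = (1 - 3) mod int N"
        using uv(3) by (intro cong_diff[unfolded cong_def]) (auto simp: cong_def)
      also have "\<dots> = int N - 2" using N by (simp add: zmod_zminus1_eq_if)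
      finally have "(u, w) \<in> parcs (G1 N)" using arc[of u w] w uv N by simp
      with wv show ?thesis by (meson reachable_adjI reachable_trans)
    qed
    have "[int x - int y = 1] (mod int N) \<or> [int x - int y = -1] (mod int N)"
      using False xy by (auto simp: G1_def)
    then show ?thesis
    proof
      assume "[int x - int y = -1] (mod int N)"
      then have "[int y - int x = 1] (mod int N)"
        using cong_minus_minus_iff[of "int y - int x" 1 "int N"] by simp
      then have "y \<rightarrow>\<^sup>*\<^bsub>G1 N\<^esub> x" by (rule step[OF xy(2) xy(1)])
      then show ?thesis by (rule symmetric_reachable[OF sym_arcs])
    qed (rule step[OF xy])
  qed
  have pv: "pverts (G1 N) = {0..<N}" by (simp add: G1_def)
  have "u \<rightarrow>\<^sup>*\<^bsub>mk_symmetric (G1 N)\<^esub> v" if "u < N" "v < N" for u v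
    by (rule reachable_mk_symmetricI[OF r[OF that]])
  then show ?thesis
    using N pv unfolding Digraph_Component.connected_def strongly_connected_def by simp
qed

end

theory Submission
  imports Defs
begin

text \<open>
  With the cyclic shift \<open>P\<close> and the all-ones matrix \<open>J\<close>, the Laplacian is \<open>M - J\<close> for the
  circulant matrix \<open>M = (N - 2) I + P + P\<^sup>-\<^sup>1\<close>. Since \<open>-\<beta>\<close> is a root of \<open>t\<^sup>2 + (N - 2) t + 1\<close>, the
  inverse of \<open>M\<close> is the circulant matrix with entries \<open>g k\<close> proportional to
  \<open>(-\<beta>)\<^sup>k + (-\<beta>)\<^sup>N\<^sup>-\<^sup>k\<close>. As \<open>M\<close> has row sums \<open>N\<close>, the pseudoinverse of the Laplacian is
  \<open>M\<^sup>-\<^sup>1 - J / N\<^sup>2\<close>, and the Kirchhoff index is \<open>N\<close> times its trace, that is \<open>N\<^sup>2 g 0 - 1\<close>.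
\<close>

section \<open>Real symmetric pseudoinverses and the Kirchhoff index\<close>

lemma mat_adjoint_real: "mat_adjoint (A :: real mat) = transpose_mat A"
proof (rule eq_matI)
  fix i j assume "i < dim_row (transpose_mat A)" "j < dim_col (transpose_mat A)"
  then show "mat_adjoint A $$ (i, j) = transpose_mat A $$ (i, j)"
    by (simp add: mat_adjoint_index)
qed (auto simp: mat_adjoint_def)

text \<open>Transposing \<open>A * X = Q\<close> gives \<open>X * A = Q\<close> as well, so the
  Penrose conditions reduce to \<open>Q\<close> being symmetric and fixing \<open>A\<close> and
  \<open>X\<close> from the left.\<close>

lemma is_pseudoinverse_symmetricI:
  fixes A X Q :: "real mat"
  assumes A: "A \<in> carrier_mat n n" and X: "X \<in> carrier_mat n n"
    and sA: "transpose_mat A = A" and sX: "transpose_mat X = X" and sQ: "transpose_mat Q = Q"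
    and AX: "A * X = Q" and QA: "Q * A = A" and QX: "Q * X = X"
  shows "is_pseudoinverse A X"
proof -
  have XA: "X * A = Q"
    using transpose_mult[OF A X] sA sX sQ AX by simp
  have "X * A * X = X" using XA QX by simp
  then show ?thesis
    using A X AX QA XA sQ by (simp add: is_pseudoinverse_def mat_adjoint_real)
qed

lemma effective_resistance_eq:
  assumes X: "pseudoinverse (laplacian G) = X" "X \<in> carrier_mat n n"
    and n: "card (pverts G) = n" and x: "x < n" and y: "y < n"
  shows "effective_resistance G x y = X $$ (x, x) - X $$ (x, y) - X $$ (y, x) + X $$ (y, y)"
proof -
  have *: "(\<Sum>j = 0..<n. f j * ((if j = x then 1 else 0) - (if j = y then 1 else 0))) = f x - f y"
    for f :: "nat \<Rightarrow> real"
    using x y by (simp add: algebra_simps sum_subtractf if_distrib[of "\<lambda>t. _ * t"] cong: if_cong)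
  have "row X i \<bullet> (unit_vec n x - unit_vec n y) = X $$ (i, x) - X $$ (i, y)" if "i < n" for i
    using X x y that *[of "\<lambda>j. X $$ (i, j)"] by (simp add: scalar_prod_def unit_vec_def)
  then have "effective_resistance G x y =
    (\<Sum>i = 0..<n. (X $$ (i, x) - X $$ (i, y)) * ((if i = x then 1 else 0) - (if i = y then 1 else 0)))"
    using X n by (simp add: effective_resistance_def scalar_prod_def unit_vec_def mult_mat_vec_def)
  also have "\<dots> = X $$ (x, x) - X $$ (x, y) - X $$ (y, x) + X $$ (y, y)"
    unfolding * by simp
  finally show ?thesis .
qed

text \<open>Each of the two diagonal terms of the resistance contributes \<open>n\<close> times the
  trace, and the two off-diagonal double sums agree after swapping the order of summation.\<close>

lemma kirchhoff_index_eq_trace: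
  assumes X: "pseudoinverse (laplacian G) = X" "X \<in> carrier_mat n n"
    and G: "pverts G = {0..<n}"
  shows "kirchhoff_index G =
    real n * (\<Sum>x = 0..<n. X $$ (x, x)) - (\<Sum>x = 0..<n. \<Sum>y = 0..<n. X $$ (x, y))"
proof -
  have "(\<Sum>x = 0..<n. \<Sum>y = 0..<n. effective_resistance G x y) =
    (\<Sum>x = 0..<n. \<Sum>y = 0..<n. X $$ (x, x) - X $$ (x, y) - X $$ (y, x) + X $$ (y, y))"
    by (intro sum.cong refl effective_resistance_eq[OF X]) (auto simp: G)
  also have "\<dots> = 2 * (real n * (\<Sum>x = 0..<n. X $$ (x, x)))
      - (\<Sum>x = 0..<n. \<Sum>y = 0..<n. X $$ (x, y)) - (\<Sum>x = 0..<n. \<Sum>y = 0..<n. X $$ (y, x))"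
    by (simp add: sum.distrib sum_subtractf sum_distrib_left)
  also have "(\<Sum>x = 0..<n. \<Sum>y = 0..<n. X $$ (y, x)) = (\<Sum>x = 0..<n. \<Sum>y = 0..<n. X $$ (x, y))"
    by (rule sum.swap)
  finally show ?thesis
    by (simp add: kirchhoff_index_def G)
qed

section \<open>The Laplacian of the complement of the cycle\<close>

definition cyc_succ :: "nat \<Rightarrow> nat \<Rightarrow> nat" where
  "cyc_succ N i = (if Suc i = N then 0 else Suc i)"

definition cyc_pred :: "nat \<Rightarrow> nat \<Rightarrow> nat" where
  "cyc_pred N i = (if i = 0 then N - 1 else i - 1)"

lemma cyc_less: "i < N \<Longrightarrow> cyc_succ N i < N" "i < N \<Longrightarrow> cyc_pred N i < N"
  by (auto simp: cyc_succ_def cyc_pred_def)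

lemma sum_cyc_succ: "(\<Sum>i = 0..<N. f (cyc_succ N i)) = (\<Sum>i = 0..<N. f i)"
  by (rule sum.reindex_bij_witness[of _ "cyc_pred N" "cyc_succ N"])
    (auto simp: cyc_succ_def cyc_pred_def split: if_splits)

lemma sum_cyc_pred: "(\<Sum>i = 0..<N. f (cyc_pred N i)) = (\<Sum>i = 0..<N. f i)"
  by (rule sum.reindex_bij_witness[of _ "cyc_succ N" "cyc_pred N"])
    (auto simp: cyc_succ_def cyc_pred_def split: if_splits)

lemma arc_G1_iff:
  assumes i: "i < N" and j: "j < N"
  shows "i \<rightarrow>\<^bsub>G1 N\<^esub> j \<longleftrightarrow> j \<noteq> i \<and> j \<noteq> cyc_succ N i \<and> j \<noteq> cyc_pred N i"
proof -
  \<comment> \<open>Since |i - j| < N, a shift by one keeps the absolute value at most N. The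
    multiples N and -N account for the wrap-around between 0 and N - 1.\<close>
  have small: "k = 0 \<or> k = int N \<or> k = - int N" if "int N dvd k" "\<bar>k\<bar> \<le> int N" for k
    using that i by (metis abs_ge_zero abs_of_nat dvd_abs_iff abs_eq_iff zdvd_not_zless zdvd_imp_le
        dual_order.antisym abs_0_eq le_less)
  have 1: "[int i - int j = 1] (mod int N) \<longleftrightarrow> j = cyc_pred N i"
  proof
    assume "[int i - int j = 1] (mod int N)"
    then have "int N dvd int i - int j - 1" by (simp add: cong_iff_dvd_diff)
    then have "int i - int j - 1 = 0 \<or> int i - int j - 1 = int N \<or> int i - int j - 1 = - int N"
      using i j by (intro small) linarith+
    then show "j = cyc_pred N i"
      using i j by (auto simp: cyc_pred_def)
  qed (use i in \<open>auto simp: cyc_pred_def cong_iff_dvd_diff of_nat_diff\<close>)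
  have 2: "[int i - int j = -1] (mod int N) \<longleftrightarrow> j = cyc_succ N i"
  proof
    assume "[int i - int j = -1] (mod int N)"
    then have "int N dvd int i - int j + 1" by (simp add: cong_iff_dvd_diff)
    then have "int i - int j + 1 = 0 \<or> int i - int j + 1 = int N \<or> int i - int j + 1 = - int N"
      using i j by (intro small) linarith+
    then show "j = cyc_succ N i"
      using i j by (auto simp: cyc_succ_def)
  qed (use i in \<open>auto simp: cyc_succ_def cong_iff_dvd_diff algebra_simps\<close>)
  show ?thesis
    using i j 1 2 by (auto simp: G1_def)
qed

lemma out_degree_G1:
  assumes N: "N \<ge> 3" and i: "i < N"
  shows "out_degree (G1 N) i = N - 3"
proof -
  have "out_arcs (G1 N) i = Pair i ` ({0..<N} - {i, cyc_succ N i, cyc_pred N i})"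
  proof -
    have "e \<in> parcs (G1 N) \<Longrightarrow> snd e < N" for e by (auto simp: G1_def)
    then show ?thesis
      using arc_G1_iff[OF i] by (force simp: out_arcs_def)
  qed
  then have "out_degree (G1 N) i = card ({0..<N} - {i, cyc_succ N i, cyc_pred N i})"
    by (simp add: out_degree_def card_image inj_on_def)
  also have "\<dots> = card {0..<N} - card {i, cyc_succ N i, cyc_pred N i}"
    using i cyc_less[OF i] by (intro card_Diff_subset) auto
  \<comment> \<open>For N \<ge> 3 a vertex and its two cycle neighbours are distinct.\<close>
  also have "card {i, cyc_succ N i, cyc_pred N i} = 3"
    using N i by (auto simp: card_insert_if cyc_succ_def cyc_pred_def)
  finally show ?thesis by simp
qed

lemma laplacian_G1_carrier: "laplacian (G1 N) \<in> carrier_mat N N"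
  by (auto simp: laplacian_def degree_matrix_def adjacency_matrix_def G1_def)

text \<open>The indicators are the entries of \<open>M\<close>, the final -1 comes from
  \<open>-J\<close>; on the diagonal (N - 2) - 1 is the degree N - 3. In this additive form a sum
  along a row collapses to three terms and a total sum.\<close>

lemma laplacian_G1_index:
  assumes N: "N \<ge> 3" and i: "i < N" and j: "j < N"
  shows "laplacian (G1 N) $$ (i, j) =
    (if j = i then real N - 2 else 0) + (if j = cyc_succ N i then 1 else 0)
      + (if j = cyc_pred N i then 1 else 0) - 1"
proof -
  have "card (pverts (G1 N)) = N" by (simp add: G1_def)
  moreover have "i \<noteq> cyc_succ N i" "i \<noteq> cyc_pred N i" "cyc_succ N i \<noteq> cyc_pred N i"
    using N i by (auto simp: cyc_succ_def cyc_pred_def)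
  ultimately show ?thesis
    using i j N arc_G1_iff[OF i j] out_degree_G1[OF N i]
    by (auto simp: laplacian_def degree_matrix_def adjacency_matrix_def)
qed

lemma transpose_laplacian_G1:
  assumes N: "N \<ge> 3"
  shows "transpose_mat (laplacian (G1 N)) = laplacian (G1 N)"
proof (rule eq_matI)
  fix i j assume "i < dim_row (laplacian (G1 N))" "j < dim_col (laplacian (G1 N))"
  then have ij: "i < N" "j < N" using laplacian_G1_carrier[of N] by auto
  then have "j = cyc_succ N i \<longleftrightarrow> i = cyc_pred N j" "j = cyc_pred N i \<longleftrightarrow> i = cyc_succ N j"
    by (auto simp: cyc_succ_def cyc_pred_def)
  then show "transpose_mat (laplacian (G1 N)) $$ (i, j) = laplacian (G1 N) $$ (i, j)"
    using ij laplacian_G1_carrier[of N] laplacian_G1_index[OF N] by auto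
qed (use laplacian_G1_carrier[of N] in auto)

lemma laplacian_G1_sum:
  assumes N: "N \<ge> 3" and i: "i < N"
  shows "(\<Sum>k = 0..<N. laplacian (G1 N) $$ (i, k) * v k) =
    (real N - 2) * v i + v (cyc_succ N i) + v (cyc_pred N i) - (\<Sum>k = 0..<N. v k)"
proof -
  have "(\<Sum>k = 0..<N. laplacian (G1 N) $$ (i, k) * v k) =
    (\<Sum>k = 0..<N. (if k = i then (real N - 2) * v k else 0) + (if k = cyc_succ N i then v k else 0)
      + (if k = cyc_pred N i then v k else 0) - v k)"
    by (rule sum.cong) (auto simp: laplacian_G1_index[OF N i] algebra_simps)
  then show ?thesis
    using i cyc_less[OF i] by (simp add: sum.distrib sum_subtractf)
qed

text \<open>
  The fundamental solution of \<open>u (k + 1) + c u k + u (k - 1) = 0\<close> on the cycle of length \<open>N\<close>, for a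
  root \<open>z\<close> of \<open>t\<^sup>2 + c t + 1\<close>. It is the periodization of \<open>z\<^bsup>\<bar>k\<bar>\<^esup> / (2 z + c)\<close>.
\<close>
definition cyc_green :: "real \<Rightarrow> real \<Rightarrow> nat \<Rightarrow> nat \<Rightarrow> real" where
  "cyc_green c z N k = (z ^ k + z ^ (N - k)) / ((2 * z + c) * (1 - z ^ N))"

text \<open>This symmetry allows |i - j| to stand in for the cyclic distance of i and j.\<close>

lemma cyc_green_reflect: "k \<le> N \<Longrightarrow> cyc_green c z N (N - k) = cyc_green c z N k"
  by (simp add: cyc_green_def add.commute)

context
  fixes c z :: real and N :: nat
  assumes root: "z\<^sup>2 + c * z + 1 = 0"
begin

text \<open>Both the powers \<open>z ^ k\<close> and the mirrored powers \<open>z ^ (N - k)\<close>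
  satisfy the recurrence, because z is a root. The largest index k + 2 may equal N, so no exponent
  is truncated.\<close>

lemma cyc_green_rec:
  assumes "Suc k < N"
  shows "cyc_green c z N k + c * cyc_green c z N (Suc k) + cyc_green c z N (Suc (Suc k)) = 0"
proof -
  define m where "m = N - Suc (Suc k)"
  have N: "N - k = Suc (Suc m)" "N - Suc k = Suc m" "N - Suc (Suc k) = m"
    using assms by (auto simp: m_def)
  have "z ^ k + z ^ (N - k) + c * (z ^ Suc k + z ^ (N - Suc k))
      + (z ^ Suc (Suc k) + z ^ (N - Suc (Suc k))) = (z ^ k + z ^ m) * (z\<^sup>2 + c * z + 1)"
    unfolding N by (simp add: algebra_simps power2_eq_square)
  also have "\<dots> = 0" using root by simp
  finally show ?thesis
    by (simp add: cyc_green_def add_divide_distrib[symmetric] del: power_Suc)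
qed

text \<open>At 0 both neighbours carry the value at 1. The denominator of \<open>cyc_green\<close>
  is chosen so that the defect of the recurrence there is exactly 1.\<close>

lemma cyc_green_source:
  assumes "N > 0" and nz: "(2 * z + c) * (1 - z ^ N) \<noteq> 0"
  shows "c * cyc_green c z N 0 + 2 * cyc_green c z N 1 = 1"
proof -
  obtain m where N: "N = Suc m" using assms by (cases N) auto
  have "c * (1 + z ^ N) + 2 * (z + z ^ m) - (2 * z + c) * (1 - z ^ N)
      = 2 * z ^ m * (z\<^sup>2 + c * z + 1)"
    unfolding N by (simp add: algebra_simps power2_eq_square)
  then have "c * (1 + z ^ N) + 2 * (z + z ^ m) = (2 * z + c) * (1 - z ^ N)"
    using root by simp
  then have "(c * (1 + z ^ N) + 2 * (z + z ^ m)) / ((2 * z + c) * (1 - z ^ N)) = 1"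
    using nz by simp
  then show ?thesis
    by (simp add: cyc_green_def add_divide_distrib distrib_left N)
qed

text \<open>This is the inverse of the circulant matrix, entry by entry: the source equation on the
  diagonal and the recurrence off it.\<close>

lemma cyc_green_circulant:
  assumes nz: "(2 * z + c) * (1 - z ^ N) \<noteq> 0" and i: "i < N" and j: "j < N"
  defines "g \<equiv> \<lambda>i j. cyc_green c z N (if i \<le> j then j - i else i - j)"
  shows "c * g i j + g (cyc_succ N i) j + g (cyc_pred N i) j = (if i = j then 1 else 0)"
proof -
  let ?g = "cyc_green c z N"
  consider "i = j" | "i < j" | "j < i" by linarith
  then show ?thesis
  proof cases
    case 1
    have "g (cyc_succ N i) i = ?g 1"
      using i cyc_green_reflect[of 1 N c z] by (auto simp: g_def cyc_succ_def)
    moreover have "g (cyc_pred N i) i = ?g 1"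
      using i cyc_green_reflect[of 1 N c z] by (auto simp: g_def cyc_pred_def)
    ultimately show ?thesis
      using 1 cyc_green_source[OF _ nz] i by (simp add: g_def)
  next
    case 2
    then obtain k where k: "j = i + Suc k" using less_imp_Suc_add by auto
    have "g (cyc_succ N i) j = ?g k" "g i j = ?g (Suc k)"
      using i j k by (auto simp: g_def cyc_succ_def)
    \<comment> \<open>The predecessor wraps only at i = 0, where its distance N - 1 - j equals N -
      (k + 2); reflection turns this into k + 2. The case j < i is the mirror image.\<close>
    moreover have "g (cyc_pred N i) j = ?g (Suc (Suc k))"
      using i j k cyc_green_reflect[of "Suc (Suc k)" N c z]
      by (cases i) (auto simp: g_def cyc_pred_def)
    ultimately show ?thesis
      using 2 cyc_green_rec[of k] j k by simp
  next
    case 3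
    then obtain k where k: "i = j + Suc k" using less_imp_Suc_add by auto
    have "g (cyc_pred N i) j = ?g k" "g i j = ?g (Suc k)"
      using i j k by (auto simp: g_def cyc_pred_def)
    moreover have "g (cyc_succ N i) j = ?g (Suc (Suc k))"
      using i j k cyc_green_reflect[of "Suc (Suc k)" N c z]
      by (auto simp: g_def cyc_succ_def)
    ultimately show ?thesis
      using 3 cyc_green_rec[of k] i k by simp
  qed
qed

end

section \<open>The pseudoinverse and the closed form\<close>

lemma pseudoinverse_laplacian_G1:
  fixes z :: real
  assumes N: "N \<ge> 3" and root: "z\<^sup>2 + (real N - 2) * z + 1 = 0"
    and nz: "(2 * z + (real N - 2)) * (1 - z ^ N) \<noteq> 0"
  defines "X \<equiv> mat N N (\<lambda>(i, j).
    cyc_green (real N - 2) z N (if i \<le> j then j - i else i - j) - 1 / (real N)\<^sup>2)"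
  shows "pseudoinverse (laplacian (G1 N)) = X"
    and "j < N \<Longrightarrow> (\<Sum>i = 0..<N. X $$ (i, j)) = 0"
proof -
  let ?c = "real N - 2" and ?L = "laplacian (G1 N)"
  define g where "g i j = cyc_green ?c z N (if i \<le> j then j - i else i - j)" for i j
  \<comment> \<open>\<open>Q\<close> is the orthogonal projection onto the vectors with coordinate
    sum 0, so it fixes every matrix whose columns sum to 0.\<close>
  define Q where "Q = mat N N (\<lambda>(i, j). (if i = j then 1 else 0) - 1 / real N)"
  have X: "X \<in> carrier_mat N N" "\<And>i j. i < N \<Longrightarrow> j < N \<Longrightarrow> X $$ (i, j) = g i j - 1 / (real N)\<^sup>2"
    by (auto simp: X_def g_def)
  have Q: "Q \<in> carrier_mat N N"
    "\<And>i j. i < N \<Longrightarrow> j < N \<Longrightarrow> Q $$ (i, j) = (if i = j then 1 else 0) - 1 / real N"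
    by (auto simp: Q_def)
  note L = laplacian_G1_carrier[of N]
  have circ: "?c * g i j + g (cyc_succ N i) j + g (cyc_pred N i) j = (if i = j then 1 else 0)"
    if "i < N" "j < N" for i j
    unfolding g_def by (rule cyc_green_circulant[OF root nz that])
  \<comment> \<open>Sum \<open>circ\<close> over i: cyclic shifts preserve the sum, so its total
    coefficient is (N - 2) + 1 + 1 = N. Subtracting 1/N^2 from each of the N entries then makes the
    columns of \<open>X\<close> sum to 0.\<close>
  have colg: "(\<Sum>i = 0..<N. g i j) = 1 / real N" if j: "j < N" for j
  proof -
    have "1 = (\<Sum>i = 0..<N. if i = j then 1 else 0 :: real)" using j by simp
    also have "\<dots> = (\<Sum>i = 0..<N. ?c * g i j + g (cyc_succ N i) j + g (cyc_pred N i) j)"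
      by (rule sum.cong) (use circ j in auto)
    also have "\<dots> = real N * (\<Sum>i = 0..<N. g i j)"
      unfolding sum.distrib sum_distrib_left[symmetric]
        sum_cyc_succ[of "\<lambda>i. g i j"] sum_cyc_pred[of "\<lambda>i. g i j"]
      by (simp add: algebra_simps)
    finally show ?thesis using N by (simp add: field_simps)
  qed
  show colX: "(\<Sum>i = 0..<N. X $$ (i, j)) = 0" if j: "j < N" for j
  proof -
    have "(\<Sum>i = 0..<N. X $$ (i, j)) = (\<Sum>i = 0..<N. g i j - 1 / (real N)\<^sup>2)"
      by (rule sum.cong) (use X j in auto)
    then show ?thesis
      using N by (simp add: sum_subtractf colg[OF j] power2_eq_square)
  qed
  have rowL: "(\<Sum>k = 0..<N. ?L $$ (i, k)) = 0" if "i < N" for i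
    using laplacian_G1_sum[OF N that, of "\<lambda>_. 1"] by simp
  have sL: "transpose_mat ?L = ?L" by (rule transpose_laplacian_G1[OF N])
  have colL: "(\<Sum>k = 0..<N. ?L $$ (k, j)) = 0" if "j < N" for j
  proof -
    have "?L $$ (k, j) = ?L $$ (j, k)" if "k < N" for k
      using arg_cong[OF sL, of "\<lambda>A. A $$ (j, k)"] L \<open>j < N\<close> that by simp
    then show ?thesis using rowL[OF that] by simp
  qed
  have QM: "Q * A = A" if A: "A \<in> carrier_mat N N"
    and col: "\<And>j. j < N \<Longrightarrow> (\<Sum>k = 0..<N. A $$ (k, j)) = 0" for A
  proof (rule eq_matI)
    fix i j assume "i < dim_row A" "j < dim_col A"
    then have ij: "i < N" "j < N" using A by auto
    have "(Q * A) $$ (i, j) = (\<Sum>k = 0..<N. Q $$ (i, k) * A $$ (k, j))"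
      using ij A Q(1) by (simp add: scalar_prod_def)
    also have "\<dots> = (\<Sum>k = 0..<N. (if k = i then A $$ (k, j) else 0) - A $$ (k, j) / real N)"
      by (rule sum.cong) (use Q(2) ij in \<open>auto simp: left_diff_distrib\<close>)
    also have "\<dots> = A $$ (i, j)"
      using ij col[OF ij(2)] by (simp add: sum_subtractf sum_divide_distrib[symmetric])
    finally show "(Q * A) $$ (i, j) = A $$ (i, j)" .
  qed (use A Q in auto)
  have LX: "?L * X = Q"
  proof (rule eq_matI)
    fix i j assume "i < dim_row Q" "j < dim_col Q"
    then have ij: "i < N" "j < N" using Q(1) by auto
    have "(?L * X) $$ (i, j) = (\<Sum>k = 0..<N. ?L $$ (i, k) * X $$ (k, j))"
      using ij L X(1) by (simp add: scalar_prod_def)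
    \<comment> \<open>The \<open>-J\<close> part only contributes a column sum of \<open>X\<close>,
      which vanishes.\<close>
    also have "\<dots> = ?c * X $$ (i, j) + X $$ (cyc_succ N i, j) + X $$ (cyc_pred N i, j)"
      using laplacian_G1_sum[OF N ij(1), of "\<lambda>k. X $$ (k, j)"] colX[OF ij(2)] by simp
    also have "\<dots> = ?c * g i j + g (cyc_succ N i) j + g (cyc_pred N i) j - real N / (real N)\<^sup>2"
      using ij cyc_less[OF ij(1)]
      by (simp add: X(2) right_diff_distrib left_diff_distrib diff_divide_distrib)
    also have "\<dots> = Q $$ (i, j)"
      using N ij by (simp add: circ Q(2) power2_eq_square)
    finally show "(?L * X) $$ (i, j) = Q $$ (i, j)" .
  qed (use L X Q in auto)
  have sX: "transpose_mat X = X" by (rule eq_matI) (auto simp: X_def)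
  have sQ: "transpose_mat Q = Q" by (rule eq_matI) (auto simp: Q_def)
  show "pseudoinverse ?L = X"
    by (intro pseudoinverse_eqI is_pseudoinverse_symmetricI[OF L X(1) sL sX sQ LX] QM L X(1) colL colX)
qed

theorem theorem4p4:
  fixes N :: nat and \<Delta> \<beta> :: real
  assumes "N \<ge> 5" and "odd N"
    and "\<Delta> = real N * (real N - 4)"
    and "\<beta> = (real N - 2 - sqrt \<Delta>) / 2"
  shows "kirchhoff_index (G1 N) =
           (real N)\<^sup>2 * (1 - \<beta> ^ N) / (sqrt \<Delta> * (1 + \<beta> ^ N)) - 1"
proof -
  have N: "N \<ge> 3" using assms(1) by simp
  have \<Delta>: "\<Delta> > 0" "\<Delta> = (real N - 2)\<^sup>2 - 4"
    using assms(1) unfolding assms(3) by (simp, simp add: power2_eq_square algebra_simps)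
  \<comment> \<open>Nonnegativity of \<beta> keeps the denominator 1 + \<beta>^N away from
    0.\<close>
  have "sqrt \<Delta> \<le> sqrt ((real N - 2)\<^sup>2)"
    using \<Delta> by (intro real_sqrt_le_mono) simp
  then have "\<beta> \<ge> 0"
    using assms(1,4) by simp
  then have pos: "1 + \<beta> ^ N > 0"
    by (simp add: add_pos_nonneg)
  \<comment> \<open>With z = -\<beta>, oddness turns 1 - z^N into 1 + \<beta>^N in the denominator
    and 1 + z^N into 1 - \<beta>^N in the numerator.\<close>
  have zN: "(- \<beta>) ^ N = - (\<beta> ^ N)" using \<open>odd N\<close> by simp
  have lin: "2 * (- \<beta>) + (real N - 2) = sqrt \<Delta>" using assms(4) by simp
  \<comment> \<open>Completing the square: (2z + c)^2 = c^2 - 4 is four times the root equation,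
    rearranged.\<close>
  have "(2 * (- \<beta>) + (real N - 2))\<^sup>2 = (real N - 2)\<^sup>2 - 4"
    unfolding lin using \<Delta> by simp
  then have root: "(- \<beta>)\<^sup>2 + (real N - 2) * (- \<beta>) + 1 = 0"
    by (simp add: power2_eq_square algebra_simps)
  have nz: "(2 * (- \<beta>) + (real N - 2)) * (1 - (- \<beta>) ^ N) \<noteq> 0"
    unfolding lin zN using \<Delta> pos by simp
  define X where "X = mat N N (\<lambda>(i, j).
    cyc_green (real N - 2) (- \<beta>) N (if i \<le> j then j - i else i - j) - 1 / (real N)\<^sup>2)"
  have inv: "pseudoinverse (laplacian (G1 N)) = X"
    and col: "\<And>j. j < N \<Longrightarrow> (\<Sum>i = 0..<N. X $$ (i, j)) = 0"
    unfolding X_def by (rule pseudoinverse_laplacian_G1[OF N root nz])+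
  have diag: "X $$ (x, x) = (1 - \<beta> ^ N) / (sqrt \<Delta> * (1 + \<beta> ^ N)) - 1 / (real N)\<^sup>2"
    if "x < N" for x
    using that lin zN by (simp add: X_def cyc_green_def)
  have "(\<Sum>x = 0..<N. \<Sum>y = 0..<N. X $$ (x, y)) = 0"
    using sum.swap[of "\<lambda>x y. X $$ (x, y)" "{0..<N}" "{0..<N}"] col by simp
  then have "kirchhoff_index (G1 N) = real N * (\<Sum>x = 0..<N. X $$ (x, x))"
    using kirchhoff_index_eq_trace[OF inv, of N] by (simp add: X_def G1_def)
  also have "\<dots> = (real N)\<^sup>2 * ((1 - \<beta> ^ N) / (sqrt \<Delta> * (1 + \<beta> ^ N)) - 1 / (real N)\<^sup>2)"
    by (simp add: diag power2_eq_square)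
  also have "\<dots> = (real N)\<^sup>2 * (1 - \<beta> ^ N) / (sqrt \<Delta> * (1 + \<beta> ^ N)) - 1"
    using N by (simp add: right_diff_distrib)
  finally show ?thesis .
qed

end
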